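(* Let $O$ and $O_0$ be a pair of open subsets in $\mathbb{R}^d$, and let $v\in \mathrm{sbh}(O)$ and $v_0\in \mathrm{sbh}(O_0)$ be a pair of functions such that $$\limsup_{\substack{y\to x\\ y\in O_0\cap O}} v(y)\le v_0(x)\quad\text{for each } x\in O_0\cap\partial O,$$ $$\limsup_{\substack{y\to x\\ y\in O_0\cap O}} v_0(y)\le v(x)\quad\text{for each } x\in O\cap\partial O_0.$$ Then the function $$V:=\begin{cases} v_0 & \text{on } O_0\setminus O,\\ \sup\{v_0,v\} & \text{on } O_0\cap O,\\ v & \text{on } O\setminus O_0,\end{cases}$$ is subharmonic on $O_0\cup O$.
   Context: Here $d\in\mathbb{N}=\{1,2,\dots\}$. For an open set $O\subset\mathbb{R}^d$, $\mathrm{sbh}(O)$ denotes the class of all subharmonic functions on $O$ (locally convex functions if $d=1$), with values in $\mathbb{R}\cup\{-\infty\}$; the function identically equal to $-\infty$ is regarded as subharmonic. Boundaries $\partial$ are taken in the one-point compactification $\mathbb{R}^d_\infty=\mathbb{R}^d\cup\{\infty\}$ of $\mathbb{R}^d$. *)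

theory Defs
  imports "HOL-Analysis.Analysis"
begin

text \<open>
  The boundary of a subset of \<open>\<real>\<^sup>d\<close> in the one-point compactification, whose points are
  \<open>Some x\<close> for \<open>x \<in> \<real>\<^sup>d\<close> and \<open>None\<close> for the point at infinity.
\<close>

definition frontier_infinity :: "'a::euclidean_space set \<Rightarrow> 'a option set" where
  "frontier_infinity S = Alexandroff_compactification euclidean frontier_of (Some ` S)"

lemma Some_in_frontier_infinity_iff: "Some x \<in> frontier_infinity S \<longleftrightarrow> x \<in> frontier S"
proof -
  let ?X = "Alexandroff_compactification (euclidean :: 'a topology)"
  have op: "open (Some -` T)" if "openin ?X T" for T
  proof -
    have "Some -` (Some ` A) = A" for A :: "'a set" by auto
    moreover have "Some -` insert None T = Some -` T" for T :: "'a option set" by auto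
    ultimately show ?thesis
      using that by (auto simp: openin_Alexandroff_compactification open_Diff)
  qed
  have cl: "Some x \<in> ?X closure_of T \<longleftrightarrow> x \<in> closure (Some -` T)" for T
  proof
    assume L: "Some x \<in> ?X closure_of T"
    show "x \<in> closure (Some -` T)"
      unfolding closure_iff_nhds_not_empty
    proof (intro allI impI)
      fix A V assume "V \<subseteq> A" "open V" "x \<in> V"
      then have "openin ?X (Some ` V)" "Some x \<in> Some ` V" by auto
      with L obtain y where "y \<in> T" "y \<in> Some ` V" unfolding in_closure_of by metis
      with \<open>V \<subseteq> A\<close> show "Some -` T \<inter> A \<noteq> {}" by auto
    qed
  next
    assume R: "x \<in> closure (Some -` T)"
    have "\<exists>y. y \<in> T \<and> y \<in> W" if "Some x \<in> W" "openin ?X W" for W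
      using R that op[of W] unfolding closure_iff_nhds_not_empty by fastforce
    then show "Some x \<in> ?X closure_of T" by (auto simp: in_closure_of)
  qed
  have "Some -` (Some ` S) = S" "Some -` (topspace ?X - Some ` S) = - S" by auto
  then show ?thesis
    by (simp add: frontier_infinity_def frontier_of_closures frontier_closures cl del: topspace_Alexandroff_compactification)
qed

text \<open>
  Folland's polar-coordinate description of the surface measure of the unit sphere, normalised to
  total mass 1: the measure of \<open>E\<close> is the relative volume of the cone
  \<open>{y \<in> ball 0 1. y / norm y \<in> E}\<close>. The origin, where \<^term>\<open>sgn\<close> vanishes, is a null set.
\<close>

definition sphere_measure :: "'a::euclidean_space measure" where
  "sphere_measure = distr (uniform_measure lborel (ball 0 1)) borel sgn"

text \<open>
  The integral of an extended real function as the difference of the integrals of its positive and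
  negative parts. It is only used for functions bounded above on the support of a finite measure,
  so that \<open>\<infinity> - \<infinity>\<close> does not occur and \<open>-\<infinity>\<close> is a legitimate value.
\<close>

definition ereal_integral :: "'a measure \<Rightarrow> ('a \<Rightarrow> ereal) \<Rightarrow> ereal" where
  "ereal_integral M f =
    enn2ereal (\<integral>\<^sup>+ y. e2ennreal (f y) \<partial>M) - enn2ereal (\<integral>\<^sup>+ y. e2ennreal (- f y) \<partial>M)"

definition sphere_mean :: "('a::euclidean_space \<Rightarrow> ereal) \<Rightarrow> 'a \<Rightarrow> real \<Rightarrow> ereal" where
  "sphere_mean u x r = ereal_integral sphere_measure (\<lambda>y. u (x + r *\<^sub>R y))"

definition upper_semicontinuous_on :: "'a::topological_space set \<Rightarrow> ('a \<Rightarrow> ereal) \<Rightarrow> bool" where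
  "upper_semicontinuous_on S u \<longleftrightarrow> (\<forall>x\<in>S. Limsup (at x within S) u \<le> u x)"

definition locally_submean_on :: "'a::euclidean_space set \<Rightarrow> ('a \<Rightarrow> ereal) \<Rightarrow> bool" where
  "locally_submean_on S u \<longleftrightarrow>
    (\<forall>x\<in>S. \<exists>e>0. ball x e \<subseteq> S \<and> (\<forall>r. 0 < r \<and> r < e \<longrightarrow> u x \<le> sphere_mean u x r))"

text \<open>The library's \<^const>\<open>convex_on\<close> does not admit the value \<open>-\<infinity>\<close>.\<close>

definition locally_convex_on :: "'a::real_normed_vector set \<Rightarrow> ('a \<Rightarrow> ereal) \<Rightarrow> bool" where
  "locally_convex_on S u \<longleftrightarrow>
    (\<forall>x\<in>S. \<exists>e>0. ball x e \<subseteq> S \<and>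
      (\<forall>y\<in>ball x e. \<forall>z\<in>ball x e. \<forall>t::real. 0 < t \<and> t < 1 \<longrightarrow>
        u ((1 - t) *\<^sub>R y + t *\<^sub>R z) \<le> ereal (1 - t) * u y + ereal t * u z))"

text \<open>
  The class of subharmonic functions on an open set \<open>S\<close>, with values in \<open>[-\<infinity>, \<infinity>)\<close>. The values
  of \<open>u\<close> off \<open>S\<close> are irrelevant. Nothing excludes the value \<open>-\<infinity>\<close> on all of \<open>S\<close> or on whole
  components of it.
\<close>

definition sbh :: "'a::euclidean_space set \<Rightarrow> ('a \<Rightarrow> ereal) set" where
  "sbh S = {u. (\<forall>x\<in>S. u x < \<infinity>) \<and>
    (if DIM('a) = 1 then locally_convex_on S u
     else upper_semicontinuous_on S u \<and> locally_submean_on S u)}"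

end

theory Submission
  imports Defs
begin

text \<open>
  Subharmonicity is upper semicontinuity together with a local inequality \<open>u x \<le> M u x r\<close> for a mean
  \<open>M\<close>, and all that gluing needs from the mean is monotonicity. Indeed the glued function \<open>V\<close>
  dominates \<open>v\<close> on \<open>U\<close> and \<open>v\<^sub>0\<close> on \<open>U\<^sub>0\<close>, and at each point it coincides with one of them, say
  \<open>V x = v x\<close> with \<open>x \<in> U\<close>; then \<open>V x = v x \<le> M v x r \<le> M V x r\<close> for small \<open>r\<close>
  (\<open>submean_on_glue\<close>). The boundary hypotheses enter only through upper semicontinuity: near a point
  of \<open>U\<^sub>0\<close> on the boundary of \<open>U\<close> the values of \<open>v\<close> are asymptotically at most \<open>v\<^sub>0 x = V x\<close>, and
  symmetrically (\<open>eventually_glue_less\<close>).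

  In dimension at least 2 the mean is the spherical mean. In dimension 1, where the definition asks
  for local convexity, the same argument runs with the two-point mean, because there local convexity
  of a function with values in \<open>[-\<infinity>, \<infinity>)\<close> is equivalent to upper semicontinuity plus the local
  two-point inequality. The hard half of this equivalence is a maximum principle
  (\<open>two_point_submean_below_affine\<close>): on a segment such a function stays below every affine function
  that bounds it at the end points. \<open>sbh_eq_usc_submean\<close> merges the two cases.
\<close>

section \<open>Upper semicontinuity\<close>

lemma usc_on_iff:
  "upper_semicontinuous_on S u \<longleftrightarrow>
    (\<forall>x\<in>S. \<forall>c>u x. eventually (\<lambda>y. u y < c) (at x within S))"
  by (auto simp: upper_semicontinuous_on_def Limsup_le_iff)

lemma usc_on_nbhd:
  assumes "upper_semicontinuous_on S u" "x \<in> S" "u x < c"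
  obtains T where "open T" "x \<in> T" "\<And>y. y \<in> T \<inter> S \<Longrightarrow> u y < c"
proof -
  have "eventually (\<lambda>y. u y < c) (at x within S)"
    using assms by (auto simp: usc_on_iff)
  then obtain T where "open T" "x \<in> T" "\<forall>y\<in>T. y \<noteq> x \<longrightarrow> y \<in> S \<longrightarrow> u y < c"
    unfolding eventually_at_topological by blast
  with assms(3) that show thesis by (metis IntD1 IntD2)
qed

text \<open>
  If the supremum were not attained, each \<open>x\<close> would have a neighbourhood on which \<open>u\<close> stays below the
  value at some fixed better point \<open>up x\<close>. Among the finitely many better points belonging to a finite
  subcover, the best one lies in none of the covering sets.
\<close>

lemma usc_on_attains_max:
  fixes u :: "'a::topological_space \<Rightarrow> ereal"
  assumes K: "compact K" "K \<noteq> {}" and u: "upper_semicontinuous_on K u"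
  obtains x where "x \<in> K" "\<And>y. y \<in> K \<Longrightarrow> u y \<le> u x"
proof (rule ccontr)
  assume "\<not> thesis"
  then have "\<forall>x\<in>K. \<exists>y\<in>K. u x < u y" using that by (meson not_le)
  then obtain up where up: "\<And>x. x \<in> K \<Longrightarrow> up x \<in> K" "\<And>x. x \<in> K \<Longrightarrow> u x < u (up x)"
    by metis
  then have "\<forall>x\<in>K. \<exists>T. open T \<and> x \<in> T \<and> (\<forall>y \<in> T \<inter> K. u y < u (up x))"
    using usc_on_nbhd[OF u] by metis
  then obtain T where T: "\<And>x. x \<in> K \<Longrightarrow> open (T x)" "\<And>x. x \<in> K \<Longrightarrow> x \<in> T x"
    "\<And>x y. x \<in> K \<Longrightarrow> y \<in> T x \<inter> K \<Longrightarrow> u y < u (up x)"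
    by metis
  obtain C where C: "C \<subseteq> K" "finite C" "K \<subseteq> (\<Union>x\<in>C. T x)"
    using compactE_image[OF K(1), of K T] T by blast
  with K(2) have "C \<noteq> {}" by auto
  with C(2) have "Max ((\<lambda>x. u (up x)) ` C) \<in> (\<lambda>x. u (up x)) ` C" by (intro Max_in) auto
  then obtain x where x: "x \<in> C" "Max ((\<lambda>x. u (up x)) ` C) = u (up x)" by auto
  then have "\<forall>y\<in>C. u (up y) \<le> u (up x)"
    using C(2) by (auto simp: x(2)[symmetric])
  have "up x \<in> K" using x(1) C up by auto
  with C(3) obtain y where "y \<in> C" "up x \<in> T y" by auto
  with T(3)[of y "up x"] C(1) \<open>up x \<in> K\<close> have "u (up x) < u (up y)" by auto
  with \<open>\<forall>y\<in>C. _\<close> \<open>y \<in> C\<close> show False by (meson leD)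
qed

lemma usc_on_closed_superlevel:
  assumes "closed K" "upper_semicontinuous_on K u"
  shows "closed {x\<in>K. c \<le> u x}"
proof -
  have "open (- {x\<in>K. c \<le> u x})"
  proof (subst open_subopen, intro ballI)
    fix x assume x: "x \<in> - {x\<in>K. c \<le> u x}"
    show "\<exists>T. open T \<and> x \<in> T \<and> T \<subseteq> - {x\<in>K. c \<le> u x}"
    proof (cases "x \<in> K")
      case True
      with x have "u x < c" by auto
      then obtain T where "open T" "x \<in> T" "\<And>y. y \<in> T \<inter> K \<Longrightarrow> u y < c"
        using usc_on_nbhd assms(2) True by blast
      then show ?thesis by (intro exI[of _ T]) (fastforce dest: leD)
    next
      case False
      then show ?thesis using assms(1) by (intro exI[of _ "-K"]) auto
    qed
  qed
  then show ?thesis by (simp add: closed_def)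
qed

lemma usc_on_diff_continuous:
  fixes l :: "'a::topological_space \<Rightarrow> real"
  assumes u: "upper_semicontinuous_on S u" and l: "continuous_on S l"
  shows "upper_semicontinuous_on S (\<lambda>x. u x - ereal (l x))"
  unfolding usc_on_iff
proof (intro ballI allI impI)
  fix x c assume x: "x \<in> S" and c: "u x - ereal (l x) < c"
  then have "u x < c + ereal (l x)" by (cases "u x"; cases c) auto
  then obtain d where d: "u x < ereal d" "ereal d < c + ereal (l x)"
    using ereal_dense2 by blast
  have "eventually (\<lambda>y. u y < ereal d) (at x within S)"
    using u x d(1) by (auto simp: usc_on_iff)
  moreover have "eventually (\<lambda>y. ereal d < c + ereal (l y)) (at x within S)"
  proof (cases c)
    case (real r)
    with d(2) have "d - r < l x" by simp
    then have "eventually (\<lambda>y. d - r < l y) (at x within S)"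
      using l x by (auto simp: continuous_on_def intro: order_tendstoD(1))
    then show ?thesis by eventually_elim (simp add: real)
  qed (use d(2) in auto)
  ultimately show "eventually (\<lambda>y. u y - ereal (l y) < c) (at x within S)"
  proof eventually_elim
    case (elim y)
    then have "u y < c + ereal (l y)" by order
    then show ?case by (cases "u y"; cases c) auto
  qed
qed

section \<open>Monotone means\<close>

text \<open>
  The comparison is required on the closed ball rather than on the sphere: \<^const>\<open>sphere_measure\<close> is
  the image of a measure under \<^const>\<open>sgn\<close>, which also takes the value 0, and every value of
  \<^const>\<open>sgn\<close> has norm at most 1.
\<close>

definition monotone_mean :: "(('a::euclidean_space \<Rightarrow> ereal) \<Rightarrow> 'a \<Rightarrow> real \<Rightarrow> ereal) \<Rightarrow> bool" where
  "monotone_mean M \<longleftrightarrow>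
    (\<forall>u w x r. 0 < r \<and> (\<forall>y\<in>cball x r. u y \<le> w y) \<longrightarrow> M u x r \<le> M w x r)"

definition submean_on ::
  "(('a::euclidean_space \<Rightarrow> ereal) \<Rightarrow> 'a \<Rightarrow> real \<Rightarrow> ereal) \<Rightarrow> 'a set \<Rightarrow> ('a \<Rightarrow> ereal) \<Rightarrow> bool" where
  "submean_on M S u \<longleftrightarrow>
    (\<forall>x\<in>S. \<exists>e>0. ball x e \<subseteq> S \<and> (\<forall>r. 0 < r \<and> r < e \<longrightarrow> u x \<le> M u x r))"

text \<open>
  The infimum over all directions makes the sub-mean inequality an inequality for every pair of
  antipodal points at distance \<open>r\<close>. On the line there is only one such pair, and this is the spherical
  mean over the two-point sphere.
\<close>

definition two_point_mean :: "('a::euclidean_space \<Rightarrow> ereal) \<Rightarrow> 'a \<Rightarrow> real \<Rightarrow> ereal" where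
  "two_point_mean u x r =
    (INF h\<in>sphere 0 r. ereal (1/2) * u (x - h) + ereal (1/2) * u (x + h))"

lemma AE_sphere_measure_norm_le: "AE y in sphere_measure. norm (y::'a::euclidean_space) \<le> 1"
proof -
  have "(sgn :: 'a \<Rightarrow> 'a) \<in> uniform_measure lborel (ball 0 1) \<rightarrow>\<^sub>M borel"
    unfolding sgn_div_norm[abs_def] by simp
  then show ?thesis
    unfolding sphere_measure_def by (subst AE_distr_iff) (auto simp: norm_sgn)
qed

text \<open>
  The positive part of the integral grows with the function and the negative part shrinks. The
  difference is monotone even when infinite, by the convention \<open>\<infinity> - \<infinity> = \<infinity>\<close>.
\<close>

lemma monotone_mean_sphere_mean: "monotone_mean sphere_mean"
  unfolding monotone_mean_def
proof (intro allI impI, elim conjE)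
  fix u w :: "'a \<Rightarrow> ereal" and x r
  assume r: "0 < r" and le: "\<forall>y\<in>cball x r. u y \<le> w y"
  have ae: "AE y in sphere_measure. u (x + r *\<^sub>R y) \<le> w (x + r *\<^sub>R y)"
    using AE_sphere_measure_norm_le
  proof eventually_elim
    case (elim y)
    with r show ?case by (intro bspec[OF le]) (auto simp: dist_norm)
  qed
  show "sphere_mean u x r \<le> sphere_mean w x r"
    unfolding sphere_mean_def ereal_integral_def
  proof (intro ereal_minus_mono)
    show "enn2ereal (\<integral>\<^sup>+y. e2ennreal (u (x + r *\<^sub>R y)) \<partial>sphere_measure)
      \<le> enn2ereal (\<integral>\<^sup>+y. e2ennreal (w (x + r *\<^sub>R y)) \<partial>sphere_measure)"
      unfolding less_eq_ennreal.rep_eq[symmetric]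
      by (intro nn_integral_mono_AE eventually_mono[OF ae] e2ennreal_mono)
    show "enn2ereal (\<integral>\<^sup>+y. e2ennreal (- w (x + r *\<^sub>R y)) \<partial>sphere_measure)
      \<le> enn2ereal (\<integral>\<^sup>+y. e2ennreal (- u (x + r *\<^sub>R y)) \<partial>sphere_measure)"
      unfolding less_eq_ennreal.rep_eq[symmetric]
      by (intro nn_integral_mono_AE eventually_mono[OF ae] e2ennreal_mono) simp
  qed
qed

lemma monotone_mean_two_point_mean: "monotone_mean two_point_mean"
  unfolding monotone_mean_def two_point_mean_def
  by (intro allI impI INF_mono' INF_superset_mono add_mono ereal_mult_left_mono order_refl)
    (auto simp: dist_norm)

lemma locally_submean_on_eq: "locally_submean_on = submean_on sphere_mean"
  by (intro ext) (simp add: locally_submean_on_def submean_on_def)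

section \<open>Local convexity on the line\<close>

text \<open>
  The maximum principle. If \<open>f\<close> minus the affine function had a positive value, it would have a
  positive maximum, attained on a closed subset of the open interval. At the leftmost point of that
  set the value on the left is strictly smaller and the value on the right is at most the maximum,
  which contradicts the two-point inequality.
\<close>

lemma two_point_submean_below_affine:
  fixes f :: "real \<Rightarrow> ereal"
  assumes usc: "upper_semicontinuous_on {0..1} f"
    and fin: "\<And>s. s \<in> {0..1} \<Longrightarrow> f s < \<infinity>"
    and mid: "\<And>s. s \<in> {0<..<1} \<Longrightarrow> \<exists>e>0. \<forall>h. 0 < h \<and> h < e \<longrightarrow>
                f s \<le> ereal (1/2) * f (s - h) + ereal (1/2) * f (s + h)"
    and ends: "f 0 \<le> ereal a" "f 1 \<le> ereal b" and t: "t \<in> {0..1}"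
  shows "f t \<le> ereal ((1 - t) * a + t * b)"
proof (rule ccontr)
  assume above: "\<not> ?thesis"
  define l where "l s = (1 - s) * a + s * b" for s
  define g where "g s = f s - ereal (l s)" for s
  have g: "upper_semicontinuous_on {0..1} g"
    unfolding g_def l_def by (intro usc_on_diff_continuous usc continuous_intros)
  obtain m where m: "m \<in> {0..1}" "\<And>s. s \<in> {0..1} \<Longrightarrow> g s \<le> g m"
    using usc_on_attains_max[OF _ _ g] by auto
  have "0 < g t" using above by (cases "f t") (auto simp: g_def l_def)
  with m t have "0 < g m" by (meson less_le_trans)
  moreover have "g m < \<infinity>" using fin[OF m(1)] by (cases "f m") (auto simp: g_def)
  ultimately obtain c where c: "g m = ereal c" "0 < c" by (cases "g m") auto
  define K where "K = {s\<in>{0..1}. ereal c \<le> g s}"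
  have "closed K" unfolding K_def by (intro usc_on_closed_superlevel g) auto
  moreover have "bounded K" by (rule bounded_subset[of "{0..1}"]) (auto simp: K_def)
  moreover have "m \<in> K" using m c by (auto simp: K_def)
  ultimately obtain s where s: "s \<in> K" "\<And>r. r \<in> K \<Longrightarrow> s \<le> r"
    using compact_attains_inf[of K] by (auto simp: compact_eq_bounded_closed)
  have "g 0 \<le> 0" using ends by (cases "f 0") (auto simp: g_def l_def)
  moreover have "g 1 \<le> 0" using ends by (cases "f 1") (auto simp: g_def l_def)
  moreover have "ereal c \<le> g s" using s by (auto simp: K_def)
  ultimately have "s \<noteq> 0" "s \<noteq> 1" using c(2) by (auto dest: order_trans)
  with s have s01: "s \<in> {0<..<1}" by (auto simp: K_def)
  then obtain e where e: "e > 0" "\<And>h. 0 < h \<Longrightarrow> h < e \<Longrightarrow>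
      f s \<le> ereal (1/2) * f (s - h) + ereal (1/2) * f (s + h)"
    using mid by metis
  define h where "h = min (e/2) (min s (1 - s))"
  have h: "0 < h" "h < e" "s - h \<in> {0..1}" "s + h \<in> {0..1}"
    using e s01 by (auto simp: h_def)
  have "s - h \<notin> K" using s(2)[of "s - h"] h by auto
  with h have "g (s - h) < ereal c" by (auto simp: K_def)
  moreover have "g (s + h) \<le> ereal c" using m h c by metis
  ultimately have "ereal (1/2) * f (s - h) + ereal (1/2) * f (s + h) < ereal (c + l s)"
    by (cases "f (s - h)"; cases "f (s + h)") (auto simp: g_def l_def field_simps)
  with e(2)[OF h(1,2)] have "f s < ereal (c + l s)" by order
  with \<open>ereal c \<le> g s\<close> show False by (cases "f s") (auto simp: g_def)
qed

text \<open>
  On a ball inside \<open>S\<close> the maximum principle is applied along the segment from \<open>y\<close> to \<open>z\<close>. Since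
  \<open>u y\<close> or \<open>u z\<close> may be \<open>-\<infinity>\<close>, the right-hand side of the convexity inequality is first replaced by
  an arbitrary real upper bound \<open>B\<close>, which leaves room for real bounds at both end points.
\<close>

lemma locally_convex_onI:
  fixes u :: "'a::euclidean_space \<Rightarrow> ereal"
  assumes fin: "\<And>x. x \<in> S \<Longrightarrow> u x < \<infinity>"
    and usc: "upper_semicontinuous_on S u" and sub: "submean_on two_point_mean S u"
  shows "locally_convex_on S u"
  unfolding locally_convex_on_def
proof
  fix x assume "x \<in> S"
  with sub obtain e where e: "e > 0" "ball x e \<subseteq> S" by (auto simp: submean_on_def)
  have "u ((1 - t) *\<^sub>R y + t *\<^sub>R z) \<le> ereal (1 - t) * u y + ereal t * u z"
    if y: "y \<in> ball x e" and z: "z \<in> ball x e" and t: "0 < t" "t < 1" for y z t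
  proof (rule ereal_le_real)
    fix B assume B: "ereal (1 - t) * u y + ereal t * u z \<le> ereal B"
    define p where "p s = (1 - s) *\<^sub>R y + s *\<^sub>R z" for s :: real
    have pS: "p s \<in> S" if "s \<in> {0..1}" for s
      using e(2) convex_ball[of x e] y z that unfolding p_def convex_alt by auto
    have cp: "isCont p s" for s unfolding p_def by (intro continuous_intros)
    have "u y < \<infinity>" "u z < \<infinity>" using fin e y z by auto
    \<comment> \<open>If one end value is \<open>-\<infinity>\<close>, its real bound is chosen so low that the affine function is
      exactly \<open>B\<close> at \<open>t\<close>, whatever the bound at the other end.\<close>
    have "\<exists>a b. u y \<le> ereal a \<and> u z \<le> ereal b \<and> (1 - t) * a + t * b \<le> B"
    proof (cases "u y = -\<infinity>")
      case True
      obtain b where "u z \<le> ereal b" using \<open>u z < \<infinity>\<close> by (cases "u z") auto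
      then show ?thesis using True t
        by (intro exI[of _ "(B - t * b) / (1 - t)"] exI[of _ b]) auto
    next
      case False
      then obtain a where a: "u y = ereal a" using \<open>u y < \<infinity>\<close> by (cases "u y") auto
      show ?thesis
      proof (cases "u z")
        case MInf
        then show ?thesis using a t
          by (intro exI[of _ a] exI[of _ "(B - (1 - t) * a) / t"]) auto
      qed (use a B \<open>u z < \<infinity>\<close> in auto)
    qed
    then obtain a b where ab: "u y \<le> ereal a" "u z \<le> ereal b" "(1 - t) * a + t * b \<le> B"
      by blast
    have "u (p t) \<le> ereal ((1 - t) * a + t * b)"
    proof (rule two_point_submean_below_affine[where f = "\<lambda>s. u (p s)"])
      show "upper_semicontinuous_on {0..1} (\<lambda>s. u (p s))"
        unfolding usc_on_iff
      proof (intro ballI allI impI)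
        fix s c assume s: "s \<in> {0..1::real}" "u (p s) < c"
        obtain T where T: "open T" "p s \<in> T" "\<And>q. q \<in> T \<inter> S \<Longrightarrow> u q < c"
          using usc_on_nbhd[OF usc pS[OF s(1)] s(2)] by blast
        have "(p \<longlongrightarrow> p s) (at s within {0..1})"
          using cp[of s] continuous_at_imp_continuous_at_within continuous_within by blast
        then have "eventually (\<lambda>r. p r \<in> T) (at s within {0..1})"
          using T topological_tendstoD by blast
        moreover have "eventually (\<lambda>r. r \<in> {0..1}) (at s within {0..1})"
          by (auto simp: eventually_at_filter)
        ultimately show "eventually (\<lambda>r. u (p r) < c) (at s within {0..1})"
          by eventually_elim (use T pS in auto)
      qed
      show "u (p s) < \<infinity>" if "s \<in> {0..1}" for s using fin pS that by auto
      show "\<exists>d>0. \<forall>h. 0 < h \<and> h < d \<longrightarrow>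
          u (p s) \<le> ereal (1/2) * u (p (s - h)) + ereal (1/2) * u (p (s + h))"
        if s: "s \<in> {0<..<1}" for s
      \<comment> \<open>A degenerate segment provides no positive displacement, hence no two-point inequality, but
        there \<open>u\<close> is constant.\<close>
      proof (cases "y = z")
        case True
        have p: "p r = z" for r unfolding p_def True by (simp add: scaleR_left_distrib[symmetric])
        have "u z \<le> ereal (1/2) * u z + ereal (1/2) * u z" by (cases "u z") auto
        then show ?thesis unfolding p by (intro exI[of _ 1]) auto
      next
        case False
        have "p s \<in> S" using pS s by auto
        then obtain d where d: "d > 0" "\<And>r. 0 < r \<Longrightarrow> r < d \<Longrightarrow> u (p s) \<le> two_point_mean u (p s) r"
          using sub by (auto simp: submean_on_def)
        have "u (p s) \<le> ereal (1/2) * u (p (s - h)) + ereal (1/2) * u (p (s + h))"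
          if h: "0 < h" "h < d / norm (z - y)" for h
        proof -
          have "0 < norm (h *\<^sub>R (z - y))" "norm (h *\<^sub>R (z - y)) < d"
            using h False by (simp_all add: pos_less_divide_eq)
          then have "u (p s) \<le> two_point_mean u (p s) (norm (h *\<^sub>R (z - y)))" by (rule d(2))
          also have "\<dots> \<le> ereal (1/2) * u (p s - h *\<^sub>R (z - y)) + ereal (1/2) * u (p s + h *\<^sub>R (z - y))"
            unfolding two_point_mean_def by (rule INF_lower) auto
          also have "p s - h *\<^sub>R (z - y) = p (s - h)" by (simp add: p_def algebra_simps)
          also have "p s + h *\<^sub>R (z - y) = p (s + h)" by (simp add: p_def algebra_simps)
          finally show ?thesis .
        qed
        then show ?thesis using d False by (intro exI[of _ "d / norm (z - y)"]) auto
      qed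
    qed (use ab t in \<open>auto simp: p_def\<close>)
    with ab show "u ((1 - t) *\<^sub>R y + t *\<^sub>R z) \<le> ereal B"
      by (metis p_def ereal_less_eq(3) order_trans)
  qed
  with e show "\<exists>e>0. ball x e \<subseteq> S \<and> (\<forall>y\<in>ball x e. \<forall>z\<in>ball x e. \<forall>t. 0 < t \<and> t < 1 \<longrightarrow>
      u ((1 - t) *\<^sub>R y + t *\<^sub>R z) \<le> ereal (1 - t) * u y + ereal t * u z)"
    by blast
qed

lemma finite_sphere_DIM_1:
  assumes "DIM('a::euclidean_space) = 1"
  shows "finite (sphere (0::'a) r)"
proof -
  obtain b :: 'a where b: "Basis = {b}" using assms card_1_singletonE by blast
  have "w \<in> {r *\<^sub>R b, (-r) *\<^sub>R b}" if "norm w = r" for w :: 'a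
  proof -
    have w: "w = (w \<bullet> b) *\<^sub>R b" using euclidean_representation[of w] by (simp add: b)
    moreover have "norm b = 1" using b by (intro norm_Basis) auto
    ultimately have "\<bar>w \<bullet> b\<bar> = r" using that by (metis norm_scaleR mult_1_right)
    with w show ?thesis by (metis abs_if insert_iff minus_minus)
  qed
  then have "sphere (0::'a) r \<subseteq> {r *\<^sub>R b, (-r) *\<^sub>R b}"
    by (intro subsetI) (simp only: mem_sphere_0)
  then show ?thesis by (rule finite_subset) simp
qed

text \<open>
  A point \<open>y\<close> near \<open>x\<close> lies between \<open>x\<close> and a point \<open>x + k\<close> at the fixed distance \<open>e/2\<close>, so convexity
  bounds \<open>u y\<close> by a weighted mean of \<open>u x\<close> and \<open>u (x + k)\<close> in which the weight of the latter tends to 0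
  as \<open>y\<close> tends to \<open>x\<close>. On the line only two points \<open>x + k\<close> occur, and hence the values \<open>u (x + k)\<close> have
  a common real bound \<open>C\<close>.
\<close>

lemma locally_convex_on_imp_usc:
  fixes u :: "'a::euclidean_space \<Rightarrow> ereal"
  assumes dim: "DIM('a) = 1" and fin: "\<And>x. x \<in> S \<Longrightarrow> u x < \<infinity>" and conv: "locally_convex_on S u"
  shows "upper_semicontinuous_on S u"
  unfolding usc_on_iff
proof (intro ballI allI impI)
  fix x c assume x: "x \<in> S" and c: "u x < c"
  obtain e where e: "e > 0" "ball x e \<subseteq> S"
    "\<And>y z t. y \<in> ball x e \<Longrightarrow> z \<in> ball x e \<Longrightarrow> 0 < t \<Longrightarrow> t < 1 \<Longrightarrow>
        u ((1 - t) *\<^sub>R y + t *\<^sub>R z) \<le> ereal (1 - t) * u y + ereal t * u z"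
    using conv x unfolding locally_convex_on_def by metis
  \<comment> \<open>The real \<open>b\<close> stands in for \<open>u x\<close>, which may be \<open>-\<infinity>\<close>.\<close>
  obtain b where b: "u x < ereal b" "ereal b < c" using c ereal_dense2 by blast
  define W where "W = (\<lambda>k. u (x + k)) ` sphere 0 (e/2)"
  have W: "finite W" unfolding W_def using finite_sphere_DIM_1[OF dim] by auto
  have Wfin: "v < \<infinity>" if "v \<in> W" for v
    using that e fin unfolding W_def by (auto simp: subset_iff dist_norm)
  obtain C where C: "\<And>v. v \<in> W \<Longrightarrow> v \<le> ereal C"
  proof -
    \<comment> \<open>Including 0 keeps the maximum from being \<open>-\<infinity>\<close>.\<close>
    have "Max (insert 0 W) < \<infinity>" using W Wfin by (subst Max_less_iff) auto
    moreover have "Max (insert 0 W) \<ge> 0" using W by auto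
    ultimately obtain C where "Max (insert 0 W) = ereal C" by (cases "Max (insert 0 W)") auto
    then have "v \<le> ereal C" if "v \<in> W" for v using W that by (metis Max_ge finite_insert insertI2)
    then show thesis using that by blast
  qed
  define s where "s y = norm (y - x) / (e/2)" for y
  have "((\<lambda>y. ereal ((1 - s y) * b + s y * C)) \<longlongrightarrow> ereal ((1 - s x) * b + s x * C)) (at x within S)"
    unfolding s_def using e(1) by (intro tendsto_intros) auto
  then have "eventually (\<lambda>y. ereal ((1 - s y) * b + s y * C) < c) (at x within S)"
    by (rule order_tendstoD(2)) (use b in \<open>auto simp: s_def\<close>)
  moreover have "eventually (\<lambda>y. y \<noteq> x \<and> y \<in> ball x (e/2)) (at x within S)"
    unfolding eventually_at_topological using e(1) by (intro exI[of _ "ball x (e/2)"]) auto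
  ultimately show "eventually (\<lambda>y. u y < c) (at x within S)"
  proof eventually_elim
    case (elim y)
    define k where "k = (1 / s y) *\<^sub>R (y - x)"
    have s: "0 < s y" "s y < 1" using elim e(1) by (auto simp: s_def dist_norm norm_minus_commute)
    have k: "norm k = e / 2" using elim e(1) by (auto simp: k_def s_def)
    have "y = (1 - s y) *\<^sub>R x + s y *\<^sub>R (x + k)"
      using s by (simp add: k_def algebra_simps)
    then have "u y \<le> ereal (1 - s y) * u x + ereal (s y) * u (x + k)"
      using e(3)[of x "x + k" "s y"] e(1) s k by (auto simp: dist_norm)
    also have "\<dots> \<le> ereal (1 - s y) * ereal b + ereal (s y) * ereal C"
      using s b k by (intro add_mono ereal_mult_left_mono C) (auto simp: W_def)
    also have "\<dots> < c" using elim by simp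
    finally show ?case .
  qed
qed

lemma locally_convex_on_imp_submean:
  assumes "locally_convex_on S u"
  shows "submean_on two_point_mean S u"
  unfolding submean_on_def
proof
  fix x assume "x \<in> S"
  then obtain e where e: "e > 0" "ball x e \<subseteq> S"
    "\<And>y z t. y \<in> ball x e \<Longrightarrow> z \<in> ball x e \<Longrightarrow> 0 < t \<Longrightarrow> t < 1 \<Longrightarrow>
        u ((1 - t) *\<^sub>R y + t *\<^sub>R z) \<le> ereal (1 - t) * u y + ereal t * u z"
    using assms unfolding locally_convex_on_def by metis
  have "u x \<le> two_point_mean u x r" if r: "0 < r" "r < e" for r
    unfolding two_point_mean_def
  proof (rule INF_greatest)
    fix h :: 'a assume h: "h \<in> sphere 0 r"
    have "(1 - 1/2) *\<^sub>R (x - h) + (1/2) *\<^sub>R (x + h) = x"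
      by (simp add: scaleR_right_distrib[symmetric] mult_2[symmetric] scaleR_2[symmetric])
    then show "u x \<le> ereal (1/2) * u (x - h) + ereal (1/2) * u (x + h)"
      using e(3)[of "x - h" "x + h" "1/2"] r h by (auto simp: dist_norm)
  qed
  with e show "\<exists>e>0. ball x e \<subseteq> S \<and> (\<forall>r. 0 < r \<and> r < e \<longrightarrow> u x \<le> two_point_mean u x r)"
    by blast
qed

text \<open>
  Both clauses of the definition take the same form, so that gluing can be treated for an arbitrary
  monotone mean.
\<close>

lemma sbh_eq_usc_submean:
  obtains M :: "('a::euclidean_space \<Rightarrow> ereal) \<Rightarrow> 'a \<Rightarrow> real \<Rightarrow> ereal"
  where "monotone_mean M"
    "\<And>S. sbh S = {u. (\<forall>x\<in>S. u x < \<infinity>) \<and> upper_semicontinuous_on S u \<and> submean_on M S u}"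
proof (cases "DIM('a) = 1")
  case True
  show thesis
  proof (rule that[OF monotone_mean_two_point_mean])
    show "sbh S = {u :: 'a \<Rightarrow> ereal. (\<forall>x\<in>S. u x < \<infinity>) \<and> upper_semicontinuous_on S u
      \<and> submean_on two_point_mean S u}" for S
      using locally_convex_onI[of S] locally_convex_on_imp_usc[OF True, of S]
        locally_convex_on_imp_submean[of S]
      unfolding sbh_def by (auto simp: True simp del: One_nat_def)
  qed
next
  case False
  show thesis
    by (rule that[OF monotone_mean_sphere_mean]) (use False in \<open>simp add: sbh_def locally_submean_on_eq\<close>)
qed

section \<open>Gluing\<close>

lemma submean_on_glue:
  assumes M: "monotone_mean M" and A: "submean_on M A u" and B: "submean_on M B w"
    and V: "\<And>x. x \<in> A \<Longrightarrow> u x \<le> V x" "\<And>x. x \<in> B \<Longrightarrow> w x \<le> V x"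
    and attained: "\<And>x. x \<in> A \<union> B \<Longrightarrow> x \<in> A \<and> V x = u x \<or> x \<in> B \<and> V x = w x"
  shows "submean_on M (A \<union> B) V"
proof -
  have *: "\<exists>e>0. ball x e \<subseteq> S \<and> (\<forall>r. 0 < r \<and> r < e \<longrightarrow> V x \<le> M V x r)"
    if S: "submean_on M S f" "\<And>x. x \<in> S \<Longrightarrow> f x \<le> V x" and x: "x \<in> S" "V x = f x" for S f x
  proof -
    obtain e where e: "e > 0" "ball x e \<subseteq> S" "\<And>r. 0 < r \<Longrightarrow> r < e \<Longrightarrow> f x \<le> M f x r"
      using S(1) x(1) by (auto simp: submean_on_def)
    have "V x \<le> M V x r" if r: "0 < r" "r < e" for r
    proof -
      have "cball x r \<subseteq> S" using r e(2) by (auto simp: subset_iff)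
      then have "M f x r \<le> M V x r" using M r S(2) unfolding monotone_mean_def by blast
      with e(3)[OF r] x show ?thesis by simp
    qed
    with e show ?thesis by blast
  qed
  show ?thesis
    unfolding submean_on_def
  proof
    fix x assume "x \<in> A \<union> B"
    with attained have "(x \<in> A \<and> V x = u x) \<or> (x \<in> B \<and> V x = w x)" by blast
    then obtain e S where "e > 0" "ball x e \<subseteq> S" "S \<subseteq> A \<union> B"
      "\<forall>r. 0 < r \<and> r < e \<longrightarrow> V x \<le> M V x r"
      using *[OF A V(1), of x] *[OF B V(2), of x] by (metis Un_upper1 Un_upper2)
    then show "\<exists>e>0. ball x e \<subseteq> A \<union> B \<and> (\<forall>r. 0 < r \<and> r < e \<longrightarrow> V x \<le> M V x r)"
      by (meson subset_trans)
  qed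
qed

text \<open>
  Upper semicontinuity of the glued function at a point of \<open>A\<close>, in a form symmetric enough to be used
  for both orders of the two functions. If \<open>x\<close> lies in \<open>B\<close>, semicontinuity of \<open>w\<close> controls \<open>w\<close>; if it
  lies on the boundary of \<open>B\<close>, the hypothesis on the upper limit does; otherwise \<open>B\<close> does not come near
  \<open>x\<close>.
\<close>

lemma eventually_glue_less:
  fixes u w :: "'a::topological_space \<Rightarrow> ereal"
  assumes "open A" "open B" and u: "upper_semicontinuous_on A u" and w: "upper_semicontinuous_on B w"
    and bd: "\<And>x. x \<in> A \<Longrightarrow> x \<in> frontier B \<Longrightarrow> Limsup (at x within (A \<inter> B)) w \<le> u x"
    and x: "x \<in> A" and c: "u x < c" "x \<in> B \<Longrightarrow> w x < c"
  shows "eventually (\<lambda>y. y \<in> A \<and> u y < c \<and> (y \<in> B \<longrightarrow> w y < c)) (at x)"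
proof -
  have "eventually (\<lambda>y. y \<in> A) (at x)" using assms by (simp add: eventually_at_in_open')
  moreover have "eventually (\<lambda>y. u y < c) (at x)"
    using u x c at_within_open[OF x \<open>open A\<close>] by (auto simp: usc_on_iff)
  moreover have "eventually (\<lambda>y. y \<in> A \<inter> B \<longrightarrow> w y < c) (at x)"
  proof -
    consider "x \<in> B" | "x \<in> frontier B" | "x \<in> - closure B"
      using \<open>open B\<close> by (auto simp: frontier_def interior_open)
    then show ?thesis
    proof cases
      case 1
      then have "eventually (\<lambda>y. w y < c) (at x)"
        using w c at_within_open[OF 1 \<open>open B\<close>] by (auto simp: usc_on_iff)
      then show ?thesis by eventually_elim simp
    next
      case 2
      then have "eventually (\<lambda>y. w y < c) (at x within (A \<inter> B))"
        using bd[OF x] c by (auto simp: Limsup_le_iff)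
      then show ?thesis by (auto simp: eventually_at_filter elim: eventually_mono)
    next
      case 3
      then have "eventually (\<lambda>y. y \<in> - closure B) (at x)"
        by (intro eventually_at_in_open') auto
      then show ?thesis by eventually_elim (use closure_subset in auto)
    qed
  qed
  ultimately show ?thesis by eventually_elim auto
qed

theorem mainTheorem1:
  fixes U U\<^sub>0 :: "'a::euclidean_space set" and v v\<^sub>0 :: "'a \<Rightarrow> ereal"
  assumes "open U" and "open U\<^sub>0"
    and "v \<in> sbh U" and "v\<^sub>0 \<in> sbh U\<^sub>0"
    and "\<And>x. x \<in> U\<^sub>0 \<Longrightarrow> Some x \<in> frontier_infinity U \<Longrightarrow>
           Limsup (at x within (U\<^sub>0 \<inter> U)) v \<le> v\<^sub>0 x"
    and "\<And>x. x \<in> U \<Longrightarrow> Some x \<in> frontier_infinity U\<^sub>0 \<Longrightarrow>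
           Limsup (at x within (U\<^sub>0 \<inter> U)) v\<^sub>0 \<le> v x"
  shows "(\<lambda>x. if x \<in> U\<^sub>0 - U then v\<^sub>0 x
              else if x \<in> U\<^sub>0 \<inter> U then sup (v\<^sub>0 x) (v x)
              else v x) \<in> sbh (U\<^sub>0 \<union> U)"
proof -
  let ?V = "\<lambda>x. if x \<in> U\<^sub>0 - U then v\<^sub>0 x else if x \<in> U\<^sub>0 \<inter> U then sup (v\<^sub>0 x) (v x) else v x"
  obtain M :: "('a \<Rightarrow> ereal) \<Rightarrow> 'a \<Rightarrow> real \<Rightarrow> ereal" where M: "monotone_mean M"
    "\<And>S. sbh S = {u. (\<forall>x\<in>S. u x < \<infinity>) \<and> upper_semicontinuous_on S u \<and> submean_on M S u}"
    using sbh_eq_usc_submean by blast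
  have v: "\<And>x. x \<in> U \<Longrightarrow> v x < \<infinity>" "upper_semicontinuous_on U v" "submean_on M U v"
    and v0: "\<And>x. x \<in> U\<^sub>0 \<Longrightarrow> v\<^sub>0 x < \<infinity>" "upper_semicontinuous_on U\<^sub>0 v\<^sub>0" "submean_on M U\<^sub>0 v\<^sub>0"
    using assms(3,4) unfolding M(2) by auto
  have "?V x < \<infinity>" if "x \<in> U\<^sub>0 \<union> U" for x
    using that v(1)[of x] v0(1)[of x] by (auto simp: sup_max max_def)
  moreover have "submean_on M (U\<^sub>0 \<union> U) ?V"
    by (rule submean_on_glue[OF M(1) v0(3) v(3)]) (auto simp: sup_max max_def)
  moreover have "upper_semicontinuous_on (U\<^sub>0 \<union> U) ?V"
    unfolding usc_on_iff
  proof (intro ballI allI impI)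
    fix x c assume x: "x \<in> U\<^sub>0 \<union> U" and c: "?V x < c"
    have "eventually (\<lambda>y. ?V y < c) (at x)"
    proof (cases "x \<in> U\<^sub>0")
      case True
      have "eventually (\<lambda>y. y \<in> U\<^sub>0 \<and> v\<^sub>0 y < c \<and> (y \<in> U \<longrightarrow> v y < c)) (at x)"
        by (rule eventually_glue_less[OF assms(2,1) v0(2) v(2)])
          (use assms(5) True c in \<open>auto simp: Some_in_frontier_infinity_iff sup_max split: if_splits\<close>)
      then show ?thesis by eventually_elim (auto simp: sup_max)
    next
      case False
      with x have "x \<in> U" by auto
      have "eventually (\<lambda>y. y \<in> U \<and> v y < c \<and> (y \<in> U\<^sub>0 \<longrightarrow> v\<^sub>0 y < c)) (at x)"
        by (rule eventually_glue_less[OF assms(1,2) v(2) v0(2)])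
          (use assms(6) \<open>x \<in> U\<close> False c in
            \<open>auto simp: Some_in_frontier_infinity_iff Int_commute split: if_splits\<close>)
      then show ?thesis by eventually_elim (auto simp: sup_max)
    qed
    then show "eventually (\<lambda>y. ?V y < c) (at x within (U\<^sub>0 \<union> U))"
      using at_le[of "U\<^sub>0 \<union> U" UNIV x] filter_leD by blast
  qed
  ultimately show ?thesis unfolding M(2) by blast
qed

end
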